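(* Let $n$ be a positive integer, $\alpha\in(n-1,n]$, $T>0$, $m\ge 1$ an integer and $h=T/m$. Let $S_{(m)}(t)=[S_0(t),\dots,S_{m-1}(t)]^{\top}$ be the vector of sample-and-hold functions and $T_{(m)}(t)=[T_0(t),\dots,T_{m-1}(t)]^{\top}$ the vector of right-handed triangular functions on $[0,T)$ with step size $h$. Then the (componentwise) Riemann--Liouville fractional integral of order $\alpha$ of $T_{(m)}$ is expressed by means of orthogonal hybrid functions as $$J^{\alpha}T_{(m)}(t)=\frac{1}{\Gamma(\alpha)}\int_0^t (t-\tau)^{\alpha-1}T_{(m)}(\tau)\,d\tau = P_{\alpha ts(m)}S_{(m)}(t)+P_{\alpha tt(m)}T_{(m)}(t),$$ where the last equality means that, for each $i\in\{0,\dots,m-1\}$, the hybrid function expansion of the function $J^{\alpha}T_i$ is the $i$-th component (numbering from $0$) of $P_{\alpha ts(m)}S_{(m)}(t)+P_{\alpha tt(m)}T_{(m)}(t)$. Here $P_{\alpha ts(m)}$ and $P_{\alpha tt(m)}$ are the $m\times m$ matrices $$P_{\alpha ts(m)}=\frac{h^{\alpha}}{\Gamma(\alpha+2)}[\![0\ \ \phi_1\ \ \phi_2\ \cdots\ \phi_{m-1}]\!],\qquad P_{\alpha tt(m)}=\frac{h^{\alpha}}{\Gamma(\alpha+2)}[\![1\ \ \psi_1\ \ \psi_2\ \cdots\ \psi_{m-1}]\!],$$ with, for $k=1,\dots,m-1$, $$\phi_k=k^{\alpha+1}-(k-1)^{\alpha}(k+\alpha),\qquad \psi_k=(k+1)^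{\alpha+1}-(k+1+\alpha)k^{\alpha}-k^{\alpha+1}+(k+\alpha)(k-1)^{\alpha}.$$
   Context: Sample-and-hold functions: for $0\le i\le m-1$, $S_i(t)=1$ if $t\in[ih,(i+1)h)$ and $S_i(t)=0$ otherwise. Right-handed triangular functions: for $0\le i\le m-1$, $T_i(t)=\frac{t-ih}{h}$ if $t\in[ih,(i+1)h)$ and $T_i(t)=0$ otherwise. Hybrid function (HF) expansion: for a real function $f$ on $[0,T]$, its HF expansion (its representation "in the orthogonal hybrid function domain") is the function $$\sum_{i=0}^{m-1}\big(c_iS_i(t)+d_iT_i(t)\big),\qquad c_i=f(ih)\ \ (0\le i\le m),\qquad d_i=c_{i+1}-c_i\ \ (0\le i\le m-1),\qquad t\in[0,T).$$ Riemann--Liouville integral: $J^{\alpha}f(t)=\frac{1}{\Gamma(\alpha)}\int_0^t(t-\tau)^{\alpha-1}f(\tau)\,d\tau$ for $t\in[0,T]$ (in particular $J^\alpha f(0)=0$ for bounded $f$). Bracket notation: $[\![a_0\ a_1\ \cdots\ a_{m-1}]\!]$ denotes the $m\times m$ upper triangular Toeplitz matrix whose $(i,j)$ entry ($0\le i,j\le m-1$) is $a_{j-i}$ if $j\ge i$ and $0$ if $j<i$. The convention $0^{\alpha}=0$ is used. *)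

theory Defs
  imports "HOL-Analysis.Analysis" "Jordan_Normal_Form.Matrix"
begin

text \<open>HOL-Analysis also provides \<open>vec\<close>, \<open>mat\<close> and \<open>$\<close> for type-indexed vectors and
  matrices; here the dimension \<open>m\<close> is a number, so the ones of \<open>Jordan_Normal_Form\<close> are used.\<close>

no_notation Finite_Cartesian_Product.vec_nth (infixl \<open>$\<close> 90)
hide_const (open) Finite_Cartesian_Product.vec Finite_Cartesian_Product.mat

definition sample_hold :: "real \<Rightarrow> nat \<Rightarrow> real \<Rightarrow> real" where
  "sample_hold h i t = (if t \<in> {real i * h ..< (real i + 1) * h} then 1 else 0)"

definition triangular :: "real \<Rightarrow> nat \<Rightarrow> real \<Rightarrow> real" where
  "triangular h i t =
     (if t \<in> {real i * h ..< (real i + 1) * h} then (t - real i * h) / h else 0)"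

definition sample_hold_vec :: "real \<Rightarrow> nat \<Rightarrow> real \<Rightarrow> real vec" where
  "sample_hold_vec h m t = vec m (\<lambda>i. sample_hold h i t)"

definition triangular_vec :: "real \<Rightarrow> nat \<Rightarrow> real \<Rightarrow> real vec" where
  "triangular_vec h m t = vec m (\<lambda>i. triangular h i t)"

text \<open>The hybrid function expansion of \<open>f\<close> on \<open>[0, m * h)\<close>; it samples \<open>f\<close> at the \<open>m + 1\<close> nodes
  \<open>0, h, \<dots>, m * h\<close>, the right end point included.\<close>

definition hf_expansion :: "real \<Rightarrow> nat \<Rightarrow> (real \<Rightarrow> real) \<Rightarrow> real \<Rightarrow> real" where
  "hf_expansion h m f t =
     (let c = (\<lambda>i::nat. f (real i * h));
          d = (\<lambda>i. c (Suc i) - c i)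
      in \<Sum>i<m. c i * sample_hold h i t + d i * triangular h i t)"

definition rl_integrand :: "real \<Rightarrow> (real \<Rightarrow> real) \<Rightarrow> real \<Rightarrow> real \<Rightarrow> real" where
  "rl_integrand \<alpha> f t \<tau> = (t - \<tau>) powr (\<alpha> - 1) * f \<tau>"

text \<open>The Riemann--Liouville integral, as a Lebesgue integral. The kernel is singular at
  \<open>\<tau> = t\<close> when \<open>\<alpha> < 1\<close>; the value that \<open>powr\<close> assigns to it there is immaterial.\<close>

definition rl_integral :: "real \<Rightarrow> (real \<Rightarrow> real) \<Rightarrow> real \<Rightarrow> real" where
  "rl_integral \<alpha> f t =
     1 / Gamma \<alpha> * set_lebesgue_integral lborel {0..t} (rl_integrand \<alpha> f t)"

definition upper_toeplitz :: "nat \<Rightarrow> (nat \<Rightarrow> real) \<Rightarrow> real mat" where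
  "upper_toeplitz m a = mat m m (\<lambda>(i, j). if i \<le> j then a (j - i) else 0)"

text \<open>Both sequences are meant for \<open>k \<ge> 1\<close> only. For \<open>k = 1\<close> the convention \<open>0\<^sup>\<alpha> = 0\<close> is that of
  \<open>powr\<close>.\<close>

definition phi :: "real \<Rightarrow> nat \<Rightarrow> real" where
  "phi \<alpha> k = real k powr (\<alpha> + 1) - (real k - 1) powr \<alpha> * (real k + \<alpha>)"

definition psi :: "real \<Rightarrow> nat \<Rightarrow> real" where
  "psi \<alpha> k = (real k + 1) powr (\<alpha> + 1) - (real k + 1 + \<alpha>) * real k powr \<alpha>
     - real k powr (\<alpha> + 1) + (real k + \<alpha>) * (real k - 1) powr \<alpha>"

definition P_ts :: "real \<Rightarrow> real \<Rightarrow> nat \<Rightarrow> real mat" where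
  "P_ts \<alpha> h m = (h powr \<alpha> / Gamma (\<alpha> + 2)) \<cdot>\<^sub>m
     upper_toeplitz m (\<lambda>k. if k = 0 then 0 else phi \<alpha> k)"

definition P_tt :: "real \<Rightarrow> real \<Rightarrow> nat \<Rightarrow> real mat" where
  "P_tt \<alpha> h m = (h powr \<alpha> / Gamma (\<alpha> + 2)) \<cdot>\<^sub>m
     upper_toeplitz m (\<lambda>k. if k = 0 then 1 else psi \<alpha> k)"

end

theory Submission
  imports Defs
begin

text \<open>The expansion of a function \<open>f\<close> depends only on its values at the nodes \<open>j * h\<close>. For
  \<open>f = J\<^sup>\<alpha> T\<^sub>i\<close> such a value is \<open>0\<close> for \<open>j \<le> i\<close>, because the support of \<open>T\<^sub>i\<close> has not been reached.
  For \<open>j = i + k\<close> with \<open>k \<ge> 1\<close> the whole support lies to the left of the node, and integration by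
  parts of \<open>(t - \<tau>)\<^sup>\<alpha>\<^sup>-\<^sup>1 (\<tau> - i * h) / h\<close>, divided by \<open>\<Gamma>(\<alpha>)\<close>, gives \<open>h\<^sup>\<alpha> \<phi>\<^sub>k / \<Gamma>(\<alpha> + 2)\<close>
  (\<open>rl_integral_triangular_node\<close>). The samples in the \<open>i\<close>-th row thus depend on \<open>j - i\<close> alone, which
  makes the coefficient matrix of the sample-and-hold functions upper triangular and Toeplitz. Since
  \<open>\<psi>\<^sub>k = \<phi>\<^sub>k\<^sub>+\<^sub>1 - \<phi>\<^sub>k\<close> for \<open>k \<ge> 1\<close>, and \<open>\<phi>\<^sub>1 - 0 = 1\<close> on the diagonal, the differences of consecutive
  samples are the entries of the second matrix.

  The kernel is unbounded at \<open>\<tau> = t\<close> if \<open>\<alpha> < 1\<close>. Its primitive remains continuous up to that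
  point because \<open>\<alpha> > 0\<close>, so the fundamental theorem of calculus still yields gauge integrals;
  nonnegativity of the kernel makes it Lebesgue integrable, and the triangular functions are
  bounded.\<close>

lemma kernel_powr_has_derivative:
  fixes \<beta> t x :: real
  assumes "x < t"
  shows "((\<lambda>\<tau>. (t - \<tau>) powr \<beta>) has_real_derivative - (\<beta> * (t - x) powr (\<beta> - 1))) (at x)"
  using assms by (auto intro!: derivative_eq_intros simp: powr_diff)

text \<open>The case \<open>b = t\<close> is the one that produces \<open>\<phi>\<^sub>1\<close>: there the integrand may be unbounded near \<open>b\<close>, so
  a primitive can be required to have the right derivative only in the interior.\<close>

lemma kernel_moment_has_integral:
  fixes \<alpha> a b t :: real
  assumes "\<alpha> > 0" and "a \<le> b" and "b \<le> t"
  shows "((\<lambda>\<tau>. (t - \<tau>) powr (\<alpha> - 1) * (\<tau> - a)) has_integral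
    ((t - a) powr (\<alpha> + 1) - (t - b) powr (\<alpha> + 1) - (\<alpha> + 1) * (b - a) * (t - b) powr \<alpha>)
      / (\<alpha> * (\<alpha> + 1))) {a..b}"
proof -
  \<comment> \<open>The primitive obtained by parts, differentiating the linear factor.\<close>
  define F where "F \<tau> = - ((\<tau> - a) * (t - \<tau>) powr \<alpha> / \<alpha>)
    - (t - \<tau>) powr (\<alpha> + 1) / (\<alpha> * (\<alpha> + 1))" for \<tau>
  have "((\<lambda>\<tau>. (t - \<tau>) powr (\<alpha> - 1) * (\<tau> - a)) has_integral F b - F a) {a..b}"
  proof (rule fundamental_theorem_of_calculus_interior)
    show "continuous_on {a..b} F"
      unfolding F_def using assms by (intro continuous_intros continuous_on_powr') auto
    fix x assume x: "x \<in> {a<..<b}"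
    have "(F has_real_derivative (t - x) powr (\<alpha> - 1) * (x - a)) (at x)"
      unfolding F_def using assms x
      by (auto intro!: derivative_eq_intros kernel_powr_has_derivative
          simp: diff_divide_distrib)
    then show "(F has_vector_derivative (t - x) powr (\<alpha> - 1) * (x - a)) (at x)"
      by (simp add: has_real_derivative_iff_has_vector_derivative)
  qed (use assms in auto)
  moreover have "F b - F a = ((t - a) powr (\<alpha> + 1) - (t - b) powr (\<alpha> + 1)
      - (\<alpha> + 1) * (b - a) * (t - b) powr \<alpha>) / (\<alpha> * (\<alpha> + 1))"
  proof -
    have "(b - a) * (t - b) powr \<alpha> / \<alpha> = (\<alpha> + 1) * (b - a) * (t - b) powr \<alpha> / (\<alpha> * (\<alpha> + 1))"
      using assms by (simp add: frac_eq_eq)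
    then show ?thesis
      unfolding F_def by (simp add: diff_divide_distrib)
  qed
  ultimately show ?thesis by simp
qed

lemma kernel_set_integrable:
  fixes \<alpha> t :: real
  assumes "\<alpha> > 0" and "0 \<le> t"
  shows "set_integrable lborel {0..t} (\<lambda>\<tau>. (t - \<tau>) powr (\<alpha> - 1))"
proof -
  define F where "F \<tau> = - ((t - \<tau>) powr \<alpha> / \<alpha>)" for \<tau>
  have "((\<lambda>\<tau>. (t - \<tau>) powr (\<alpha> - 1)) has_integral F t - F 0) {0..t}"
  proof (rule fundamental_theorem_of_calculus_interior)
    show "continuous_on {0..t} F"
      unfolding F_def using assms by (intro continuous_intros continuous_on_powr') auto
    fix x assume x: "x \<in> {0<..<t}"
    have "(F has_real_derivative (t - x) powr (\<alpha> - 1)) (at x)"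
      unfolding F_def using assms x
      by (auto intro!: derivative_eq_intros kernel_powr_has_derivative)
    then show "(F has_vector_derivative (t - x) powr (\<alpha> - 1)) (at x)"
      by (simp add: has_real_derivative_iff_has_vector_derivative)
  qed (use assms in auto)
  then have "(\<lambda>\<tau>. (t - \<tau>) powr (\<alpha> - 1)) absolutely_integrable_on {0..t}"
    by (intro nonnegative_absolutely_integrable_1) auto
  then show ?thesis
    unfolding set_integrable_def by (subst (asm) integrable_completion) auto
qed

lemma rl_integrand_set_integrable:
  fixes \<alpha> t :: real
  assumes "\<alpha> > 0" and "0 \<le> t" and "f \<in> borel_measurable borel"
    and bound: "\<And>\<tau>. \<bar>f \<tau>\<bar> \<le> B"
  shows "set_integrable lborel {0..t} (rl_integrand \<alpha> f t)"
proof (rule set_integrable_bound)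
  show "set_integrable lborel {0..t} (\<lambda>\<tau>. B * (t - \<tau>) powr (\<alpha> - 1))"
    using kernel_set_integrable[OF assms(1,2)] by (rule set_integrable_mult_right)
  show "set_borel_measurable lborel {0..t} (rl_integrand \<alpha> f t)"
    unfolding set_borel_measurable_def rl_integrand_def using assms(3) by measurable
  have "\<bar>rl_integrand \<alpha> f t \<tau>\<bar> \<le> \<bar>B * (t - \<tau>) powr (\<alpha> - 1)\<bar>" for \<tau>
    using mult_right_mono[OF order_trans[OF bound abs_ge_self], of "(t - \<tau>) powr (\<alpha> - 1)" \<tau>]
    by (simp add: rl_integrand_def abs_mult mult.commute)
  then show "AE \<tau> in lborel. \<tau> \<in> {0..t} \<longrightarrow>
      norm (rl_integrand \<alpha> f t \<tau>) \<le> norm (B * (t - \<tau>) powr (\<alpha> - 1))"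
    by simp
qed

lemma triangular_integrand_set_integrable:
  assumes "\<alpha> > 0" and "h > 0" and "0 \<le> t"
  shows "set_integrable lborel {0..t} (rl_integrand \<alpha> (triangular h i) t)"
proof (rule rl_integrand_set_integrable)
  show "triangular h i \<in> borel_measurable borel"
    unfolding triangular_def[abs_def] by measurable
  show "\<bar>triangular h i \<tau>\<bar> \<le> 1" for \<tau>
    using assms by (auto simp: triangular_def field_simps)
qed (use assms in auto)

text \<open>The left end \<open>t = i * h\<close> is included because \<open>T\<^sub>i\<close> starts there with the value \<open>0\<close>.\<close>

lemma rl_integral_triangular_before:
  assumes "t \<le> real i * h"
  shows "rl_integral \<alpha> (triangular h i) t = 0"
proof -
  have "indicator {0..t} \<tau> *\<^sub>R rl_integrand \<alpha> (triangular h i) t \<tau> = 0" for \<tau>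
    using assms by (auto simp: rl_integrand_def triangular_def indicator_def)
  then show ?thesis
    unfolding rl_integral_def set_lebesgue_integral_def
    by (simp only: integral_zero mult_zero_right)
qed

lemma rl_integral_triangular_after:
  assumes "\<alpha> > 0" and "h > 0" and t: "(real i + 1) * h \<le> t"
  shows "rl_integral \<alpha> (triangular h i) t =
    ((t - real i * h) powr (\<alpha> + 1) - (t - (real i + 1) * h) powr (\<alpha> + 1)
      - (\<alpha> + 1) * h * (t - (real i + 1) * h) powr \<alpha>) / (h * Gamma (\<alpha> + 2))"
proof -
  define a where "a = real i * h"
  define b where "b = (real i + 1) * h"
  have ab: "b - a = h" "0 \<le> a" "a \<le> b" "b \<le> t"
    using assms by (auto simp: a_def b_def algebra_simps)
  define I where "I = ((t - a) powr (\<alpha> + 1) - (t - b) powr (\<alpha> + 1)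
      - (\<alpha> + 1) * h * (t - b) powr \<alpha>) / (\<alpha> * (\<alpha> + 1))"
  have "((\<lambda>\<tau>. (t - \<tau>) powr (\<alpha> - 1) * (\<tau> - a)) has_integral I) {a..b}"
    using kernel_moment_has_integral[OF assms(1) ab(3,4)] unfolding I_def ab(1) .
  then have "((\<lambda>\<tau>. (t - \<tau>) powr (\<alpha> - 1) * (\<tau> - a) / h) has_integral I / h) {a..b}"
    by (rule has_integral_divide)
  \<comment> \<open>The triangular function jumps back to \<open>0\<close> at the right end of its support.\<close>
  then have "(rl_integrand \<alpha> (triangular h i) t has_integral I / h) {a..b}"
    by (rule has_integral_spike_finite[where S = "{b}", rotated 2])
       (auto simp: rl_integrand_def triangular_def a_def b_def)
  then have "(rl_integrand \<alpha> (triangular h i) t has_integral I / h) {0..t}"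
    by (rule has_integral_on_superset)
       (use ab in \<open>auto simp: rl_integrand_def triangular_def simp flip: a_def b_def\<close>)
  moreover have "set_integrable lborel {0..t} (rl_integrand \<alpha> (triangular h i) t)"
    using assms ab by (intro triangular_integrand_set_integrable) auto
  ultimately have "set_lebesgue_integral lborel {0..t} (rl_integrand \<alpha> (triangular h i) t) = I / h"
    using set_borel_integral_eq_integral(2) integral_unique by metis
  moreover have "Gamma (\<alpha> + 2) = (\<alpha> + 1) * (\<alpha> * Gamma \<alpha>)"
  proof -
    have "\<alpha> + 1 \<notin> \<int>\<^sub>\<le>\<^sub>0" "\<alpha> \<notin> \<int>\<^sub>\<le>\<^sub>0"
      using assms(1) by (auto dest: nonpos_Ints_nonpos)
    then show ?thesis
      using Gamma_plus1[of "\<alpha> + 1"] Gamma_plus1[of \<alpha>] by (simp add: add.assoc)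
  qed
  ultimately show ?thesis
    unfolding rl_integral_def I_def a_def b_def by (simp add: mult_ac)
qed

text \<open>With \<open>t = j * h\<close> and \<open>k = j - i\<close>, the two distances from \<open>t\<close> to the ends of the support are
  \<open>k * h\<close> and \<open>(k - 1) * h\<close>, so that a power of \<open>h\<close> factors out and only \<open>k\<close> remains. The case
  distinction is needed because the formula for \<open>\<phi>\<close> does not give \<open>0\<close> at \<open>k = 0\<close>.\<close>

lemma rl_integral_triangular_node:
  assumes "\<alpha> > 0" and "h > 0"
  shows "rl_integral \<alpha> (triangular h i) (real j * h) =
    h powr \<alpha> / Gamma (\<alpha> + 2) * (if j \<le> i then 0 else phi \<alpha> (j - i))"
proof (cases "j \<le> i")
  case True
  then show ?thesis
    using assms by (simp add: rl_integral_triangular_before)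
next
  case False
  define k where "k = j - i"
  have k: "real j = real i + real k" "1 \<le> k"
    using False by (auto simp: k_def)
  have d: "real j * h - real i * h = real k * h"
      "real j * h - (real i + 1) * h = (real k - 1) * h"
    by (simp_all add: k algebra_simps)
  have "rl_integral \<alpha> (triangular h i) (real j * h) =
    ((real k * h) powr (\<alpha> + 1) - ((real k - 1) * h) powr (\<alpha> + 1)
      - (\<alpha> + 1) * h * ((real k - 1) * h) powr \<alpha>) / (h * Gamma (\<alpha> + 2))"
    using False assms by (subst rl_integral_triangular_after) (auto simp: d)
  also have "\<dots> = h powr \<alpha> / Gamma (\<alpha> + 2) * (real k powr (\<alpha> + 1)
      - (real k - 1) powr (\<alpha> + 1) - (\<alpha> + 1) * (real k - 1) powr \<alpha>)"
  proof -
    have "(real k * h) powr (\<alpha> + 1) = h * h powr \<alpha> * real k powr (\<alpha> + 1)"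
      "((real k - 1) * h) powr (\<alpha> + 1) = h * h powr \<alpha> * (real k - 1) powr (\<alpha> + 1)"
      "((real k - 1) * h) powr \<alpha> = h powr \<alpha> * (real k - 1) powr \<alpha>"
      using assms k(2) by (simp_all add: powr_mult powr_add)
    then have "(real k * h) powr (\<alpha> + 1) - ((real k - 1) * h) powr (\<alpha> + 1)
      - (\<alpha> + 1) * h * ((real k - 1) * h) powr \<alpha> = h * (h powr \<alpha> * (real k powr (\<alpha> + 1)
      - (real k - 1) powr (\<alpha> + 1) - (\<alpha> + 1) * (real k - 1) powr \<alpha>))"
      by (simp add: algebra_simps)
    then show ?thesis
      using assms(2) by simp
  qed
  also have "real k powr (\<alpha> + 1) - (real k - 1) powr (\<alpha> + 1)
      - (\<alpha> + 1) * (real k - 1) powr \<alpha> = phi \<alpha> k"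
    using k(2) by (simp add: phi_def powr_add algebra_simps)
  finally show ?thesis
    using False by (simp add: k_def)
qed

lemma phi_one: "phi \<alpha> 1 = 1"
  by (simp add: phi_def)

lemma psi_eq_phi_diff: "psi \<alpha> k = phi \<alpha> (Suc k) - phi \<alpha> k"
  by (simp add: psi_def phi_def algebra_simps)

lemma scaled_toeplitz_mult_vec_index:
  assumes "i < m"
  shows "((c \<cdot>\<^sub>m upper_toeplitz m a) *\<^sub>v vec m v) $ i =
    (\<Sum>j<m. c * (if i \<le> j then a (j - i) else 0) * v j)"
  using assms
  by (auto simp: upper_toeplitz_def scalar_prod_def atLeast0LessThan intro!: sum.cong)

theorem theorem3p2:
  fixes n m :: nat and \<alpha> T h :: real
  assumes "n \<ge> 1" and "real n - 1 < \<alpha>" and "\<alpha> \<le> real n"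
    and "T > 0" and "m \<ge> 1" and "h = T / real m"
  shows "\<forall>i<m.
    (\<forall>t\<in>{0..T}. set_integrable lborel {0..t} (rl_integrand \<alpha> (triangular h i) t)) \<and>
    (\<forall>t\<in>{0..<T}.
       hf_expansion h m (rl_integral \<alpha> (triangular h i)) t =
         (P_ts \<alpha> h m *\<^sub>v sample_hold_vec h m t + P_tt \<alpha> h m *\<^sub>v triangular_vec h m t) $ i)"
proof (intro allI impI conjI ballI)
  have \<alpha>: "\<alpha> > 0" and h: "h > 0"
    using assms by auto
  fix i assume i: "i < m"
  show "set_integrable lborel {0..t} (rl_integrand \<alpha> (triangular h i) t)" if "t \<in> {0..T}" for t
    using that \<alpha> h by (intro triangular_integrand_set_integrable) auto
  fix t :: real
  define C where "C = h powr \<alpha> / Gamma (\<alpha> + 2)"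
  define c where "c j = rl_integral \<alpha> (triangular h i) (real j * h)" for j
  have c: "c j = C * (if i \<le> j then (if j - i = 0 then 0 else phi \<alpha> (j - i)) else 0)" for j
    unfolding c_def C_def rl_integral_triangular_node[OF \<alpha> h] by auto
  have d: "c (Suc j) - c j = C * (if i \<le> j then (if j - i = 0 then 1 else psi \<alpha> (j - i)) else 0)"
    for j
  proof (cases "i < j")
    case True
    then show ?thesis
      by (simp add: c psi_eq_phi_diff Suc_diff_le algebra_simps)
  next
    \<comment> \<open>On the diagonal \<open>j = i\<close> the sample rises from \<open>0\<close> to \<open>C * \<phi>\<^sub>1\<close>; to its left both samples are \<open>0\<close>.\<close>
    case False
    then show ?thesis
      using phi_one by (auto simp: c not_less_eq_eq le_Suc_eq)
  qed
  have "hf_expansion h m (rl_integral \<alpha> (triangular h i)) t =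
      (\<Sum>j<m. c j * sample_hold h j t) + (\<Sum>j<m. (c (Suc j) - c j) * triangular h j t)"
    unfolding hf_expansion_def Let_def c_def by (rule sum.distrib)
  also have "\<dots> = (P_ts \<alpha> h m *\<^sub>v sample_hold_vec h m t) $ i
      + (P_tt \<alpha> h m *\<^sub>v triangular_vec h m t) $ i"
    unfolding d unfolding c P_ts_def P_tt_def sample_hold_vec_def triangular_vec_def
      scaled_toeplitz_mult_vec_index[OF i] C_def ..
  also have "\<dots> = (P_ts \<alpha> h m *\<^sub>v sample_hold_vec h m t
      + P_tt \<alpha> h m *\<^sub>v triangular_vec h m t) $ i"
    using i by (simp add: P_tt_def upper_toeplitz_def)
  finally show "hf_expansion h m (rl_integral \<alpha> (triangular h i)) t =
      (P_ts \<alpha> h m *\<^sub>v sample_hold_vec h m t + P_tt \<alpha> h m *\<^sub>v triangular_vec h m t) $ i" .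
qed

end
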